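(* Let $(W,S)$ be a Coxeter system with Coxeter graph $\Upsilon$, and let $\mathcal S_{\rm fi}$ be the set of non-empty subsets of $S$ that are irreducible and of spherical type. Define $\Gamma = (\Gamma, \le, \mu, (\varphi_x)_{x \in V(\Gamma)})$ as follows. The vertex set is $V(\Gamma)=\{x_X\mid X\in\mathcal S_{\rm fi}\}$, in one-to-one correspondence with $\mathcal S_{\rm fi}$. Two distinct vertices $x_X,x_Y$ are connected by an edge if $X\subset Y$, or $Y\subset X$, or $\Upsilon_{X\cup Y}$ is the disjoint union of $\Upsilon_X$ and $\Upsilon_Y$. Set $x_X\le x_Y$ if $X\subseteq Y$, and $\mu(x_X)=2$ for all $X\in\mathcal S_{\rm fi}$. For $x_X\in V(\Gamma)$ and a vertex $x_Y$ of $\mathrm{star}_{x_X}(\Gamma)$, set $\varphi_{x_X}(x_Y)=x_{w_X(Y)}$ if $Y\subset X$ and $\varphi_{x_X}(x_Y)=x_Y$ otherwise. Then $(\Gamma, \le, \mu, (\varphi_x)_{x \in V(\Gamma)})$ is a trickle graph.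
   Context: **Coxeter notation.** For $X\subseteq S$, $W_X$ is the subgroup of $W$ generated by $X$ and $\Upsilon_X$ is the full Coxeter subgraph of $\Upsilon$ spanned by $X$. $X$ is irreducible if $\Upsilon_X$ is connected and of spherical type if $W_X$ is finite. If $X$ is of spherical type, $w_X$ is the unique element of $W_X$ of maximal length with respect to $S$; it satisfies $w_X^2=1$ and $w_XXw_X=X$; for $Y\subseteq X$, $w_X(Y)=w_XYw_X^{-1}$. "$\Upsilon_{X\cup Y}$ is the disjoint union of $\Upsilon_X$ and $\Upsilon_Y$" means $X\cap Y=\emptyset$ and $\{s,t\}\notin E(\Upsilon)$ (i.e. $st=ts$) for all $s\in X$, $t\in Y$. **Trickle graphs.** For a simplicial graph $\Gamma$ (no loops or multiple edges, possibly infinite) with vertex set $V(\Gamma)$ and edge set $E(\Gamma)$, $\mathrm{star}_x(\Gamma)$ is the full subgraph spanned by $x$ and all vertices adjacent to $x$. A trickle graph is a quadruple $(\Gamma,\le,\mu,(\varphi_x)_{x\in V(\Gamma)})$ where $\Gamma$ is a simplicial graph, $\le$ is a partial order on $V(\Gamma)$, $\mu:V(\Gamma)\to\mathbb N_{\ge 2}\cup\{\infty\}$ is a labeling, and each $\varphi_x$ is a graph automorphism of $\mathrm{star}_x(\Gamma)$, such that, writing $x||y$ if $x\not\le y$ and $y\not\le x$, and $E_{||}(\Gamma)=\{\{x,y\}\in E(\Gamma)\mid x||y\}$: (a) if $x<y$ then $\{x,y\}\in E(\Gamma)$; (b) if $\{x,y\}\in E_{||}(\Gamma)$ and $z\le y$,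 then $\{x,z\}\in E_{||}(\Gamma)$; (c) for all $x$ and all $y,z\in \mathrm{star}_x(\Gamma)$: $z\le y$ iff $\varphi_x(z)\le\varphi_x(y)$; (d) for all $x$ and $y\in\mathrm{star}_x(\Gamma)$: if $\varphi_x(y)\ne y$ then $y<x$; (e) if $\mu(x)$ is finite, then $\varphi_x$ has finite order dividing $\mu(x)$; (f) $\mu(\varphi_x(y))=\mu(y)$ for all $x$ and $y\in \mathrm{star}_x(\Gamma)$; (g) if $z<y<x$ then $(\varphi_x\circ\varphi_y)(z)=(\varphi_{y'}\circ\varphi_x)(z)$ where $y'=\varphi_x(y)$. *)

theory Defs
  imports
    "HOL-Algebra.Bij"
    "HOL-Algebra.Generated_Groups"
    "HOL-Algebra.Multiplicative_Group"
    "HOL-Library.Extended_Nat"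
begin

section \<open>Group presentations\<close>

text \<open>
  A group word over \<open>S\<close> is a list of letters \<open>(s, e)\<close> with \<open>s \<in> S\<close>, where
  \<open>(s, True)\<close> stands for the generator \<open>s\<close> and \<open>(s, False)\<close> for its formal inverse.
\<close>

type_synonym 'a gword = "('a \<times> bool) list"

definition gwords :: "'a set \<Rightarrow> 'a gword set" where
  "gwords S = lists (S \<times> UNIV)"

definition gword_eval :: "('a, 'b) monoid_scheme \<Rightarrow> 'a gword \<Rightarrow> 'a" where
  "gword_eval G w = foldr (\<lambda>(s, e) g. (if e then s else inv\<^bsub>G\<^esub> s) \<otimes>\<^bsub>G\<^esub> g) w \<one>\<^bsub>G\<^esub>"

inductive gword_step :: "'a set \<Rightarrow> 'a gword set \<Rightarrow> 'a gword \<Rightarrow> 'a gword \<Rightarrow> bool"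
  for S :: "'a set" and R :: "'a gword set" where
  cancel: "u \<in> gwords S \<Longrightarrow> v \<in> gwords S \<Longrightarrow> s \<in> S \<Longrightarrow>
             gword_step S R (u @ [(s, e), (s, \<not> e)] @ v) (u @ v)"
| relator: "u \<in> gwords S \<Longrightarrow> v \<in> gwords S \<Longrightarrow> r \<in> R \<Longrightarrow>
             gword_step S R (u @ r @ v) (u @ v)"

text \<open>
  The group presented by \<open>\<langle>S | R\<rangle>\<close> is the set of group words modulo the equivalence generated by
  \<open>gword_step S R\<close>. So \<open>G\<close> is presented by \<open>\<langle>S | R\<rangle>\<close>, via the inclusion of \<open>S\<close> into \<open>G\<close>,
  iff \<open>S\<close> generates \<open>G\<close> and the words that are trivial in \<open>G\<close> are
  exactly those equivalent to the empty word.
\<close>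

definition has_presentation :: "('a, 'b) monoid_scheme \<Rightarrow> 'a set \<Rightarrow> 'a gword set \<Rightarrow> bool" where
  "has_presentation G S R \<longleftrightarrow>
     group G \<and> S \<subseteq> carrier G \<and> R \<subseteq> gwords S \<and> generate G S = carrier G \<and>
     (\<forall>w \<in> gwords S. gword_eval G w = \<one>\<^bsub>G\<^esub> \<longleftrightarrow> equivclp (gword_step S R) w [])"


section \<open>Graphs\<close>

text \<open>Simplicial graphs are given by a vertex set and a set of two-element sets of vertices.\<close>

definition simplicial_graph :: "'v set \<Rightarrow> 'v set set \<Rightarrow> bool" where
  "simplicial_graph V E \<longleftrightarrow> (\<forall>e \<in> E. e \<subseteq> V \<and> card e = 2)"

definition full_edges :: "'v set set \<Rightarrow> 'v set \<Rightarrow> 'v set set" where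
  "full_edges E X = {e \<in> E. e \<subseteq> X}"

definition connected_graph :: "'v set \<Rightarrow> 'v set set \<Rightarrow> bool" where
  "connected_graph V E \<longleftrightarrow> (\<forall>x \<in> V. \<forall>y \<in> V. (x, y) \<in> {(a, b). {a, b} \<in> E}\<^sup>*)"

definition graph_automorphism :: "'v set \<Rightarrow> 'v set set \<Rightarrow> ('v \<Rightarrow> 'v) \<Rightarrow> bool" where
  "graph_automorphism V E f \<longleftrightarrow>
     bij_betw f V V \<and> (\<forall>y \<in> V. \<forall>z \<in> V. {y, z} \<in> E \<longleftrightarrow> {f y, f z} \<in> E)"

definition star :: "'v set set \<Rightarrow> 'v \<Rightarrow> 'v set" where
  "star E x = insert x {y. {x, y} \<in> E}"


section \<open>Trickle graphs\<close>

text \<open>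
  The values of \<open>le\<close> and \<open>\<mu>\<close> outside \<open>V\<close>, and of \<open>\<phi> x\<close> outside the star of \<open>x\<close>, are irrelevant.
  The order of \<open>\<phi> x\<close> is its order in the group of bijections of the star; \<open>ord\<close> is \<open>0\<close> for
  elements of infinite order.
\<close>

locale trickle_graph =
  fixes V :: "'v set"
    and E :: "'v set set"
    and le :: "'v \<Rightarrow> 'v \<Rightarrow> bool"
    and \<mu> :: "'v \<Rightarrow> enat"
    and \<phi> :: "'v \<Rightarrow> 'v \<Rightarrow> 'v"
  assumes graph: "simplicial_graph V E"
    and order: "partial_order_on V {(x, y). x \<in> V \<and> y \<in> V \<and> le x y}"
    and label_ge_2: "x \<in> V \<Longrightarrow> 2 \<le> \<mu> x"
    and automorphism: "x \<in> V \<Longrightarrow> graph_automorphism (star E x) (full_edges E (star E x)) (\<phi> x)"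
    and cond_a: "\<lbrakk>x \<in> V; y \<in> V; le x y; x \<noteq> y\<rbrakk> \<Longrightarrow> {x, y} \<in> E"
    and cond_b: "\<lbrakk>x \<in> V; y \<in> V; z \<in> V; {x, y} \<in> E; \<not> le x y; \<not> le y x; le z y\<rbrakk>
                  \<Longrightarrow> {x, z} \<in> E \<and> \<not> le x z \<and> \<not> le z x"
    and cond_c: "\<lbrakk>x \<in> V; y \<in> star E x; z \<in> star E x\<rbrakk> \<Longrightarrow> le z y \<longleftrightarrow> le (\<phi> x z) (\<phi> x y)"
    and cond_d: "\<lbrakk>x \<in> V; y \<in> star E x; \<phi> x y \<noteq> y\<rbrakk> \<Longrightarrow> le y x \<and> y \<noteq> x"
    and cond_e: "\<lbrakk>x \<in> V; \<mu> x = enat n\<rbrakk> \<Longrightarrow>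
                  group.ord (BijGroup (star E x)) (restrict (\<phi> x) (star E x)) \<noteq> 0 \<and>
                  group.ord (BijGroup (star E x)) (restrict (\<phi> x) (star E x)) dvd n"
    and cond_f: "\<lbrakk>x \<in> V; y \<in> star E x\<rbrakk> \<Longrightarrow> \<mu> (\<phi> x y) = \<mu> y"
    and cond_g: "\<lbrakk>x \<in> V; y \<in> V; z \<in> V; le z y; z \<noteq> y; le y x; y \<noteq> x\<rbrakk>
                  \<Longrightarrow> \<phi> x (\<phi> y z) = \<phi> (\<phi> x y) (\<phi> x z)"


section \<open>Coxeter systems\<close>

definition coxeter_matrix :: "'a set \<Rightarrow> ('a \<Rightarrow> 'a \<Rightarrow> enat) \<Rightarrow> bool" where
  "coxeter_matrix S m \<longleftrightarrow>
     (\<forall>s \<in> S. m s s = 1) \<and>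
     (\<forall>s \<in> S. \<forall>t \<in> S. s \<noteq> t \<longrightarrow> m s t = m t s \<and> 2 \<le> m s t)"

text \<open>The relators \<open>(s t)^(m s t)\<close> for finite \<open>m s t\<close>; the case \<open>s = t\<close> gives \<open>s\<^sup>2\<close>.\<close>

definition coxeter_relators :: "'a set \<Rightarrow> ('a \<Rightarrow> 'a \<Rightarrow> enat) \<Rightarrow> 'a gword set" where
  "coxeter_relators S m =
     {concat (replicate k [(s, True), (t, True)]) | s t k. s \<in> S \<and> t \<in> S \<and> m s t = enat k}"

definition coxeter_system ::
    "('a, 'b) monoid_scheme \<Rightarrow> 'a set \<Rightarrow> ('a \<Rightarrow> 'a \<Rightarrow> enat) \<Rightarrow> bool" where
  "coxeter_system W S m \<longleftrightarrow>
     coxeter_matrix S m \<and> has_presentation W S (coxeter_relators S m)"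

text \<open>The edge set of the Coxeter graph \<open>\<Upsilon>\<close>.\<close>

definition coxeter_edges :: "'a set \<Rightarrow> ('a \<Rightarrow> 'a \<Rightarrow> enat) \<Rightarrow> 'a set set" where
  "coxeter_edges S m = {{s, t} | s t. s \<in> S \<and> t \<in> S \<and> s \<noteq> t \<and> 3 \<le> m s t}"

definition irreducible_subset :: "'a set \<Rightarrow> ('a \<Rightarrow> 'a \<Rightarrow> enat) \<Rightarrow> 'a set \<Rightarrow> bool" where
  "irreducible_subset S m X \<longleftrightarrow> connected_graph X (full_edges (coxeter_edges S m) X)"

definition spherical_subset :: "('a, 'b) monoid_scheme \<Rightarrow> 'a set \<Rightarrow> bool" where
  "spherical_subset W X \<longleftrightarrow> finite (generate W X)"

definition S_fi ::
    "('a, 'b) monoid_scheme \<Rightarrow> 'a set \<Rightarrow> ('a \<Rightarrow> 'a \<Rightarrow> enat) \<Rightarrow> 'a set set" where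
  "S_fi W S m = {X. X \<subseteq> S \<and> X \<noteq> {} \<and> irreducible_subset S m X \<and> spherical_subset W X}"

text \<open>Word length; no inverses are needed since the elements of \<open>S\<close> are involutions.\<close>

definition word_length :: "('a, 'b) monoid_scheme \<Rightarrow> 'a set \<Rightarrow> 'a \<Rightarrow> nat" where
  "word_length W S w =
     (LEAST n. \<exists>ss. set ss \<subseteq> S \<and> length ss = n \<and> foldr (\<lambda>s g. s \<otimes>\<^bsub>W\<^esub> g) ss \<one>\<^bsub>W\<^esub> = w)"

definition longest_element :: "('a, 'b) monoid_scheme \<Rightarrow> 'a set \<Rightarrow> 'a set \<Rightarrow> 'a" where
  "longest_element W S X = (THE w. is_arg_max (word_length W S) (\<lambda>w. w \<in> generate W X) w)"

definition longest_conj :: "('a, 'b) monoid_scheme \<Rightarrow> 'a set \<Rightarrow> 'a set \<Rightarrow> 'a set \<Rightarrow> 'a set" where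
  "longest_conj W S X Y =
     (\<lambda>y. longest_element W S X \<otimes>\<^bsub>W\<^esub> y \<otimes>\<^bsub>W\<^esub> inv\<^bsub>W\<^esub> (longest_element W S X)) ` Y"


section \<open>The trickle graph of a Coxeter system\<close>

text \<open>
  The vertex \<open>x\<^sub>X\<close> is represented by the set \<open>X\<close> itself, so the vertex set is \<open>S_fi W S m\<close> and
  the order is inclusion.
\<close>

definition coxeter_disjoint_union ::
    "'a set \<Rightarrow> ('a \<Rightarrow> 'a \<Rightarrow> enat) \<Rightarrow> 'a set \<Rightarrow> 'a set \<Rightarrow> bool" where
  "coxeter_disjoint_union S m X Y \<longleftrightarrow>
     X \<inter> Y = {} \<and> (\<forall>s \<in> X. \<forall>t \<in> Y. {s, t} \<notin> coxeter_edges S m)"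

definition coxeter_trickle_edges ::
    "('a, 'b) monoid_scheme \<Rightarrow> 'a set \<Rightarrow> ('a \<Rightarrow> 'a \<Rightarrow> enat) \<Rightarrow> 'a set set set" where
  "coxeter_trickle_edges W S m =
     {{X, Y} | X Y. X \<in> S_fi W S m \<and> Y \<in> S_fi W S m \<and> X \<noteq> Y \<and>
        (X \<subset> Y \<or> Y \<subset> X \<or> coxeter_disjoint_union S m X Y)}"

definition coxeter_trickle_map ::
    "('a, 'b) monoid_scheme \<Rightarrow> 'a set \<Rightarrow> 'a set \<Rightarrow> 'a set \<Rightarrow> 'a set" where
  "coxeter_trickle_map W S X Y = (if Y \<subset> X then longest_conj W S X Y else Y)"

end

theory Submission
  imports Defs
begin

text \<open>
  Every trickle axiom except the last concerns the ordered graph alone or a single map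
  \<open>\<phi>\<^sub>X\<close>. On the vertices below \<open>X\<close> it is induced by conjugation with the longest
  element \<open>w\<^sub>X\<close>, and it fixes all other vertices of the star. So these axioms follow once
  conjugation by \<open>w\<^sub>X\<close> is known to be an involution of \<open>X\<close> that respects the edges of the
  Coxeter graph: such a map preserves connected subsets, inclusions and disjoint unions. The
  last axiom follows from \<open>w\<^sub>X w\<^sub>Y = w\<^sub>Y\<^sub>' w\<^sub>X\<close> with \<open>Y' = w\<^sub>X(Y)\<close>, that is, that the longest
  element of \<open>w\<^sub>X(Y)\<close> is \<open>w\<^sub>X w\<^sub>Y w\<^sub>X\<close>; this holds because conjugation by \<open>w\<^sub>X\<close>,
  permuting the generators in \<open>X\<close>, preserves length on \<open>W\<^sub>X\<close>
  (\<open>longest_element_lconj\<close>).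

  All information on \<open>W\<close> is extracted from its presentation by letting it act. An assignment
  of maps to the generators that satisfies the Coxeter relations gives each element of \<open>W\<close> a
  well-defined action (\<open>action_well_defined\<close>), and three actions suffice:

  \<^item> the sign action on two points, which shows that all words for an element have the same
    parity of length;

  \<^item> the action on \<open>W \<times> bool\<close> by conjugation on the first factor, with a sign that records
    how often a word meets a given reflection. It yields the exchange condition
    (\<open>exchange\<close>), and from there every element of \<open>W\<^sub>X\<close> is the end of a reduced word for
    a longest element (\<open>longest_suffix\<close>), so that \<open>w\<^sub>X\<close> is unique, is an involution and
    normalises \<open>X\<close>;

  \<^item> the contragredient of the geometric representation, on real functions. It shows that
    generators joined by an edge do not commute (\<open>not_commute\<close>). Hence the edges of the
    Coxeter graph are exactly the non-commuting pairs of generators, and are preserved by any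
    conjugation that permutes \<open>X\<close> (\<open>lconj_edge_iff\<close>).
\<close>

section \<open>Words in the generators\<close>

definition wprod :: "('a, 'b) monoid_scheme \<Rightarrow> 'a list \<Rightarrow> 'a" where
  "wprod G ss = foldr (\<lambda>s g. s \<otimes>\<^bsub>G\<^esub> g) ss \<one>\<^bsub>G\<^esub>"

context group
begin

lemma wprod_Nil [simp]: "wprod G [] = \<one>"
  by (simp add: wprod_def)

lemma wprod_Cons [simp]: "wprod G (s # ss) = s \<otimes> wprod G ss"
  by (simp add: wprod_def)

lemma wprod_closed: "set ss \<subseteq> carrier G \<Longrightarrow> wprod G ss \<in> carrier G"
  by (induction ss) auto

lemma wprod_append:
  "set ss \<subseteq> carrier G \<Longrightarrow> set ts \<subseteq> carrier G \<Longrightarrow> wprod G (ss @ ts) = wprod G ss \<otimes> wprod G ts"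
  by (induction ss) (auto simp: wprod_closed m_assoc)

lemma wprod_rev:
  assumes "set ss \<subseteq> carrier G" "\<And>s. s \<in> set ss \<Longrightarrow> s \<otimes> s = \<one>"
  shows "wprod G (rev ss) = inv (wprod G ss)"
  using assms
proof (induction ss)
  case (Cons a ss)
  have "inv a = a" using Cons.prems by (simp add: inv_equality)
  then show ?case using Cons by (simp add: wprod_append wprod_closed inv_mult_group)
qed simp

lemma gword_eval_positive: "gword_eval G (map (\<lambda>s. (s, True)) ss) = wprod G ss"
  by (induction ss) (auto simp: gword_eval_def)

lemma wprod_concat_replicate:
  assumes "s \<in> carrier G" "t \<in> carrier G"
  shows "wprod G (concat (replicate k [s, t])) = (s \<otimes> t) [^] k"
proof (induction k)
  case (Suc k)
  have "(s \<otimes> t) [^] Suc k = (s \<otimes> t) \<otimes> (s \<otimes> t) [^] k"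
    by (rule nat_pow_Suc2) (use assms in simp)
  then show ?case using Suc assms by (simp add: m_assoc)
qed simp

end


section \<open>Actions of a Coxeter group\<close>

locale coxeter_group =
  fixes W :: "('a, 'b) monoid_scheme" (structure)
    and S :: "'a set"
    and m :: "'a \<Rightarrow> 'a \<Rightarrow> enat"
  assumes system: "coxeter_system W S m"
begin

sublocale group W
  using system by (simp add: coxeter_system_def has_presentation_def)

lemma S_carrier: "S \<subseteq> carrier W"
  using system by (simp add: coxeter_system_def has_presentation_def)

lemma S_closed [simp]: "s \<in> S \<Longrightarrow> s \<in> carrier W"
  using S_carrier by blast

lemma word_closed [simp]: "set ss \<subseteq> S \<Longrightarrow> wprod W ss \<in> carrier W"
  using S_carrier by (simp add: wprod_closed subset_trans)

lemma word_append:
  "set ss \<subseteq> S \<Longrightarrow> set ts \<subseteq> S \<Longrightarrow> wprod W (ss @ ts) = wprod W ss \<otimes> wprod W ts"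
  by (meson S_carrier subset_trans wprod_append)

lemma diagonal: "s \<in> S \<Longrightarrow> m s s = enat 1"
  using system by (simp add: coxeter_system_def coxeter_matrix_def one_enat_def)

lemma matrix_sym: "s \<in> S \<Longrightarrow> t \<in> S \<Longrightarrow> m s t = m t s"
  using system by (cases "s = t") (auto simp: coxeter_system_def coxeter_matrix_def)

lemma matrix_ge_2: "s \<in> S \<Longrightarrow> t \<in> S \<Longrightarrow> s \<noteq> t \<Longrightarrow> 2 \<le> m s t"
  using system by (auto simp: coxeter_system_def coxeter_matrix_def)

lemma trivial_word_iff:
  "w \<in> gwords S \<Longrightarrow>
     gword_eval W w = \<one> \<longleftrightarrow> equivclp (gword_step S (coxeter_relators S m)) w []"
  using system by (simp add: coxeter_system_def has_presentation_def)

lemma relation: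
  assumes "s \<in> S" "t \<in> S" "m s t = enat k"
  shows "(s \<otimes> t) [^] k = \<one>"
proof -
  let ?r = "concat (replicate k [(s, True), (t, True)])"
  have r: "?r \<in> coxeter_relators S m"
    using assms by (auto simp: coxeter_relators_def)
  have "gword_step S (coxeter_relators S m) ([] @ ?r @ []) ([] @ [])"
    by (rule gword_step.relator) (auto simp: gwords_def r)
  then have "equivclp (gword_step S (coxeter_relators S m)) ?r []"
    by (simp add: r_into_equivclp)
  moreover have "?r \<in> gwords S"
    using assms by (auto simp: gwords_def split: if_splits)
  ultimately have "gword_eval W ?r = \<one>"
    using trivial_word_iff by blast
  moreover have "?r = map (\<lambda>s. (s, True)) (concat (replicate k [s, t]))"
    by (simp add: map_concat)
  ultimately show ?thesis
    using assms by (simp add: gword_eval_positive wprod_concat_replicate)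
qed

lemma involution [simp]: "s \<in> S \<Longrightarrow> s \<otimes> s = \<one>"
  using relation[OF _ _ diagonal] by (simp add: nat_pow_eone)

lemma involution_left [simp]: "s \<in> S \<Longrightarrow> x \<in> carrier W \<Longrightarrow> s \<otimes> (s \<otimes> x) = x"
  by (simp add: m_assoc[symmetric])

lemma inv_generator [simp]: "s \<in> S \<Longrightarrow> inv s = s"
  by (simp add: inv_equality)

lemma word_rev: "set ss \<subseteq> S \<Longrightarrow> wprod W (rev ss) = inv (wprod W ss)"
  by (rule wprod_rev) auto

text \<open>
  Reversing a word inverts its action, as it inverts its value in the group.
\<close>

lemma foldr_involutions:
  assumes "set us \<subseteq> S" "\<And>s. s \<in> S \<Longrightarrow> act s \<circ> act s = id"
  shows "foldr act us (foldr act (rev us) x) = x"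
  using assms(1)
proof (induction us arbitrary: x)
  case (Cons a us)
  have "act a (act a y) = y" for y
    using assms(2)[of a] Cons.prems by (auto simp: fun_eq_iff)
  then show ?case using Cons by simp
qed simp

text \<open>
  Killing a pair of inverse letters or a relator does not change the action of a word, because
  the relation \<open>(s s)\<^sup>1\<close> makes each generator act as an involution; a letter and its formal
  inverse can therefore be given the same action. So a word with trivial value acts trivially,
  and this is applied to one word followed by the reverse of the other.
\<close>

lemma action_well_defined:
  fixes act :: "'a \<Rightarrow> 'c \<Rightarrow> 'c"
  assumes rel: "\<And>s t k. s \<in> S \<Longrightarrow> t \<in> S \<Longrightarrow> m s t = enat k \<Longrightarrow> (act s \<circ> act t) ^^ k = id"
    and us: "set us \<subseteq> S" and vs: "set vs \<subseteq> S" and eq: "wprod W us = wprod W vs"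
  shows "foldr act us = foldr act vs"
proof -
  define A where "A w = foldr (\<lambda>p. act (fst p)) w" for w :: "'a gword"
  have A_append: "A (u @ v) = A u \<circ> A v" for u v
    by (simp add: A_def fun_eq_iff)
  have sq: "act s \<circ> act s = id" if "s \<in> S" for s
    using rel[OF that that diagonal[OF that]] by simp
  have A_relator: "A (concat (replicate k [(s, True), (t, True)])) = (act s \<circ> act t) ^^ k" for s t k
    by (induction k) (auto simp: A_def)
  have A_positive: "A (map (\<lambda>s. (s, True)) ss) = foldr act ss" for ss
    by (induction ss) (auto simp: A_def)
  have step: "A w = A w'" if "gword_step S (coxeter_relators S m) w w'" for w w'
    using that
  proof cases
    case (cancel u v s e)
    have "A [(s, e), (s, \<not> e)] = id" using sq[OF cancel(5)] by (simp add: A_def)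
    then show ?thesis by (simp only: cancel A_append id_comp comp_id)
  next
    case (relator u v r)
    then obtain s t k where "r = concat (replicate k [(s, True), (t, True)])"
      "s \<in> S" "t \<in> S" "m s t = enat k" by (auto simp: coxeter_relators_def)
    then have "A r = id" using rel A_relator by simp
    then show ?thesis by (simp only: relator A_append id_comp comp_id)
  qed
  have equiv: "A w = A w'" if "equivclp (gword_step S (coxeter_relators S m)) w w'" for w w'
    using that
    by (induction rule: equivclp_induct) (auto dest: step)
  let ?w = "map (\<lambda>s. (s, True)) (us @ rev vs)"
  have "gword_eval W ?w = wprod W us \<otimes> inv (wprod W vs)"
    using us vs by (simp only: gword_eval_positive) (simp add: word_append word_rev)
  also have "\<dots> = \<one>" using eq vs by simp
  finally have "equivclp (gword_step S (coxeter_relators S m)) ?w []"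
    by (subst trivial_word_iff[symmetric]) (use us vs in \<open>auto simp: gwords_def\<close>)
  then have "A ?w = id" using equiv by (auto simp: A_def)
  moreover have "A ?w = foldr act us \<circ> foldr act (rev vs)"
    by (simp only: map_append A_append A_positive)
  ultimately have *: "foldr act us (foldr act (rev vs) x) = x" for x
    by (simp add: fun_eq_iff)
  have "foldr act us x = foldr act vs x" for x
  proof -
    have "foldr act (rev vs) (foldr act vs x) = x"
      using foldr_involutions[of "rev vs" act x] vs sq by simp
    then show ?thesis using *[of "foldr act vs x"] by simp
  qed
  then show ?thesis by blast
qed


section \<open>Word length\<close>

abbreviation len :: "'a \<Rightarrow> nat" where
  "len \<equiv> word_length W S"

definition reduced :: "'a list \<Rightarrow> bool" where
  "reduced ss \<longleftrightarrow> set ss \<subseteq> S \<and> len (wprod W ss) = length ss"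

text \<open>
  The sign representation: every Coxeter relator has even length, so generators may act by negation.
\<close>

lemma parity_well_defined:
  assumes "set us \<subseteq> S" "set vs \<subseteq> S" "wprod W us = wprod W vs"
  shows "even (length us) \<longleftrightarrow> even (length vs)"
proof -
  have "(Not \<circ> Not) ^^ k = id" for k
    by (induction k) (auto simp: fun_eq_iff)
  then have "foldr (\<lambda>_. Not) us = foldr (\<lambda>_. Not) vs"
    using assms by (intro action_well_defined) auto
  moreover have "foldr (\<lambda>_. Not) ss b = (b = even (length ss))" for ss :: "'a list" and b
    by (induction ss) auto
  ultimately show ?thesis by metis
qed

lemma len_le: "set ss \<subseteq> S \<Longrightarrow> len (wprod W ss) \<le> length ss"
  unfolding word_length_def wprod_def by (rule Least_le) auto

lemma generate_word:
  assumes "w \<in> generate W X" "X \<subseteq> S"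
  shows "\<exists>ss. set ss \<subseteq> X \<and> wprod W ss = w"
  using assms(1)
proof (induction rule: generate.induct)
  case one
  show ?case by (intro exI[of _ "[]"]) simp
next
  case (incl h)
  then show ?case using assms(2) by (intro exI[of _ "[h]"]) auto
next
  case (inv h)
  then show ?case using assms(2) by (intro exI[of _ "[h]"]) auto
next
  case (eng h1 h2)
  then obtain us vs where "set us \<subseteq> X" "wprod W us = h1" "set vs \<subseteq> X" "wprod W vs = h2"
    by blast
  moreover from this have "set us \<subseteq> S" "set vs \<subseteq> S" using assms(2) by auto
  ultimately show ?case by (intro exI[of _ "us @ vs"]) (simp add: word_append)
qed

lemma word_generate: "set ss \<subseteq> X \<Longrightarrow> wprod W ss \<in> generate W X"
  by (induction ss) (auto intro: generate.intros)

lemma reduced_word: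
  assumes "w \<in> carrier W"
  shows "\<exists>ss. reduced ss \<and> wprod W ss = w"
proof -
  have "w \<in> generate W S"
    using assms system by (simp add: coxeter_system_def has_presentation_def)
  then obtain ts where "set ts \<subseteq> S" "wprod W ts = w"
    using generate_word by blast
  then have "\<exists>n ss. set ss \<subseteq> S \<and> length ss = n \<and> foldr (\<lambda>s g. s \<otimes> g) ss \<one> = w"
    by (auto simp: wprod_def)
  then have "\<exists>ss. set ss \<subseteq> S \<and> length ss = len w \<and> foldr (\<lambda>s g. s \<otimes> g) ss \<one> = w"
    unfolding word_length_def by (rule LeastI_ex)
  then show ?thesis by (auto simp: reduced_def wprod_def)
qed

lemma len_inv:
  assumes "w \<in> carrier W"
  shows "len (inv w) = len w"
proof -
  have le: "len (inv v) \<le> len v" if v: "v \<in> carrier W" for v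
  proof -
    obtain ss where "reduced ss" "wprod W ss = v" using reduced_word[OF v] by blast
    then show ?thesis using len_le[of "rev ss"] word_rev[of ss] by (auto simp: reduced_def)
  qed
  show ?thesis using le[OF assms] le[of "inv w"] assms by simp
qed

lemma len_mult_le: "x \<in> carrier W \<Longrightarrow> y \<in> carrier W \<Longrightarrow> len (x \<otimes> y) \<le> len x + len y"
proof -
  assume "x \<in> carrier W" "y \<in> carrier W"
  then obtain us vs where "reduced us" "wprod W us = x" "reduced vs" "wprod W vs = y"
    using reduced_word by metis
  then show ?thesis using len_le[of "us @ vs"] by (auto simp: reduced_def word_append)
qed

lemma len_generator_le: "s \<in> S \<Longrightarrow> len s \<le> 1"
  using len_le[of "[s]"] by simp

text \<open>
  Equality of the two lengths is excluded by parity.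
\<close>

lemma len_mult_generator_less:
  assumes "w \<in> carrier W" "s \<in> S" "len (w \<otimes> s) \<le> len w"
  shows "len (w \<otimes> s) < len w"
proof -
  obtain us where us: "reduced us" "wprod W us = w"
    using reduced_word[OF assms(1)] by blast
  obtain vs where vs: "reduced vs" "wprod W vs = w \<otimes> s"
    using reduced_word[of "w \<otimes> s"] assms by auto
  have "even (length (us @ [s])) \<longleftrightarrow> even (length vs)"
    using us vs assms by (intro parity_well_defined) (auto simp: reduced_def word_append)
  then have "length us \<noteq> length vs" by auto
  then show ?thesis using us vs assms(3) by (auto simp: reduced_def)
qed


section \<open>The exchange condition\<close>

text \<open>
  The action behind the exchange condition: \<open>s\<close> conjugates the first component and flips
  the sign exactly when that component is \<open>s\<close> itself. Acting with the word
  \<open>s\<^sub>1 \<dots> s\<^sub>n\<close> on \<open>(r, e)\<close> flips the sign once for each \<open>i\<close> with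
  \<open>r = s\<^sub>n \<dots> s\<^sub>i \<dots> s\<^sub>n\<close>. Any element of the group is admitted for \<open>r\<close>, not
  only reflections, and points outside the carrier are left fixed so that the relations can be
  stated for total functions.
\<close>

definition refl_act :: "'a \<Rightarrow> 'a \<times> bool \<Rightarrow> 'a \<times> bool" where
  "refl_act s = (\<lambda>(r, e). if r \<in> carrier W then (s \<otimes> r \<otimes> s, e \<noteq> (r = s)) else (r, e))"

lemma conj_generator_eq_iff:
  "t \<in> S \<Longrightarrow> x \<in> carrier W \<Longrightarrow> y \<in> carrier W \<Longrightarrow> t \<otimes> x \<otimes> t = y \<longleftrightarrow> x = t \<otimes> y \<otimes> t"
  by (auto simp: m_assoc)

lemma dihedral_power_swap:
  assumes "s \<in> S" "t \<in> S"
  shows "t \<otimes> (s \<otimes> t) [^] (j::nat) = (t \<otimes> s) [^] j \<otimes> t"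
proof (induction j)
  case (Suc j)
  have "t \<otimes> (s \<otimes> t) [^] Suc j = (t \<otimes> (s \<otimes> t) [^] j) \<otimes> (s \<otimes> t)"
    using assms by (simp add: m_assoc)
  also have "\<dots> = (t \<otimes> s) [^] Suc j \<otimes> t"
    using assms by (simp add: Suc m_assoc)
  finally show ?case .
qed (use assms in simp)

lemma dihedral_power_inverse:
  assumes "s \<in> S" "t \<in> S"
  shows "(s \<otimes> t) [^] (j::nat) = inv ((t \<otimes> s) [^] j)"
proof -
  have "s \<otimes> t = inv (t \<otimes> s)"
    using assms by (simp add: inv_mult_group)
  then show ?thesis using assms by (simp only: nat_pow_inv m_closed S_closed)
qed

text \<open>
  The flips happen at the reflections \<open>(t s)\<^sup>i t\<close> of the dihedral subgroup of \<open>s\<close> and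
  \<open>t\<close>, two of them for each factor \<open>s t\<close>.
\<close>

lemma refl_act_power:
  assumes s: "s \<in> S" and t: "t \<in> S" and r: "r \<in> carrier W"
  shows "((refl_act s \<circ> refl_act t) ^^ j) (r, e) =
    ((s \<otimes> t) [^] j \<otimes> r \<otimes> (t \<otimes> s) [^] j,
     e \<noteq> odd (\<Sum>i<2 * j. of_bool (r = (t \<otimes> s) [^] i \<otimes> t) :: nat))"
proof (induction j)
  case 0
  then show ?case using r by simp
next
  case (Suc j)
  let ?p = "t \<otimes> s" and ?q = "s \<otimes> t"
  let ?x = "?q [^] j \<otimes> r \<otimes> ?p [^] j"
  have closed: "?p \<in> carrier W" "?q \<in> carrier W" "?x \<in> carrier W" "t \<in> carrier W" "s \<in> carrier W"
    using s t r by auto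
  have conj: "?x = y \<longleftrightarrow> r = ?p [^] j \<otimes> y \<otimes> ?q [^] j" if y: "y \<in> carrier W" for y
  proof -
    have q: "?q [^] j = inv (?p [^] j)" by (rule dihedral_power_inverse[OF s t])
    have P: "?p [^] j \<in> carrier W" using closed by simp
    have cancel: "?p [^] j \<otimes> (inv (?p [^] j) \<otimes> z) = z" "inv (?p [^] j) \<otimes> (?p [^] j \<otimes> z) = z"
      if "z \<in> carrier W" for z
      using P that by (simp_all add: m_assoc[symmetric])
    show ?thesis unfolding q using P y r
      by (auto simp: m_assoc cancel)
  qed
  have first: "?x = t \<longleftrightarrow> r = ?p [^] (2 * j) \<otimes> t"
  proof -
    have "?p [^] j \<otimes> t \<otimes> ?q [^] j = ?p [^] j \<otimes> (?p [^] j \<otimes> t)"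
      using closed by (simp add: m_assoc dihedral_power_swap[OF s t])
    also have "\<dots> = ?p [^] (2 * j) \<otimes> t"
      using closed by (simp add: m_assoc[symmetric] nat_pow_mult mult_2)
    finally show ?thesis using conj[of t] closed by simp
  qed
  have second: "t \<otimes> ?x \<otimes> t = s \<longleftrightarrow> r = ?p [^] (2 * j + 1) \<otimes> t"
  proof -
    have "t \<otimes> ?x \<otimes> t = s \<longleftrightarrow> ?x = t \<otimes> s \<otimes> t"
      using conj_generator_eq_iff[OF t closed(3,5)] .
    also have "\<dots> \<longleftrightarrow> r = ?p [^] j \<otimes> (t \<otimes> s \<otimes> t) \<otimes> ?q [^] j"
      using conj[of "t \<otimes> s \<otimes> t"] closed by simp
    also have "?p [^] j \<otimes> (t \<otimes> s \<otimes> t) \<otimes> ?q [^] j = ?p [^] j \<otimes> ?p \<otimes> (t \<otimes> ?q [^] j)"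
      using closed by (simp add: m_assoc)
    also have "\<dots> = (?p [^] Suc j \<otimes> ?p [^] j) \<otimes> t"
      using closed by (simp add: m_assoc dihedral_power_swap[OF s t])
    also have "?p [^] Suc j \<otimes> ?p [^] j = ?p [^] (2 * j + 1)"
      using closed by (simp only: nat_pow_mult) (simp add: mult_2)
    finally show ?thesis .
  qed
  have conj_Suc: "s \<otimes> (t \<otimes> ?x \<otimes> t) \<otimes> s = ?q [^] Suc j \<otimes> r \<otimes> ?p [^] Suc j"
    using closed r by (simp add: m_assoc nat_pow_Suc2 del: nat_pow_Suc)
       (simp add: m_assoc[symmetric] nat_pow_Suc2[symmetric])
  have "(refl_act s \<circ> refl_act t) (?x, b) =
     (?q [^] Suc j \<otimes> r \<otimes> ?p [^] Suc j,
       (b \<noteq> (r = ?p [^] (2 * j) \<otimes> t)) \<noteq> (r = ?p [^] (2 * j + 1) \<otimes> t))" for b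
    unfolding first[symmetric] second[symmetric] conj_Suc[symmetric]
    using closed by (simp add: refl_act_def)
  note step = this
  let ?f = "\<lambda>i. of_bool (r = ?p [^] i \<otimes> t) :: nat"
  have parity: "((e \<noteq> odd n) \<noteq> P) \<noteq> Q \<longleftrightarrow> e \<noteq> odd (n + of_bool P + of_bool Q)" for n :: nat and P Q
    by (cases P; cases Q) auto
  have sum: "(\<Sum>i<2 * Suc j. ?f i) = (\<Sum>i<2 * j. ?f i) + ?f (2 * j) + ?f (2 * j + 1)"
    by simp
  have "((refl_act s \<circ> refl_act t) ^^ Suc j) (r, e) =
      (refl_act s \<circ> refl_act t) (((refl_act s \<circ> refl_act t) ^^ j) (r, e))"
    by simp
  then show ?case
    by (simp only: Suc step parity sum)
qed

text \<open>
  The sequence \<open>(t s)\<^sup>i t\<close> has period \<open>k\<close>, so among its first \<open>2 k\<close> terms each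
  reflection is met an even number of times and the signs cancel.
\<close>

lemma refl_act_relation:
  assumes s: "s \<in> S" and t: "t \<in> S" and k: "m s t = enat k"
  shows "(refl_act s \<circ> refl_act t) ^^ k = id"
proof
  fix x :: "'a \<times> bool"
  obtain r e where x: "x = (r, e)" by fastforce
  show "((refl_act s \<circ> refl_act t) ^^ k) x = id x"
  proof (cases "r \<in> carrier W")
    case True
    let ?p = "t \<otimes> s" and ?f = "\<lambda>i. of_bool (r = (t \<otimes> s) [^] i \<otimes> t) :: nat"
    have p: "?p [^] k = \<one>"
      using relation[of t s k] s t k matrix_sym[of s t] by simp
    have "?p [^] (i + k) = ?p [^] i" for i
      using p s t by (simp add: nat_pow_mult[symmetric])
    then have "(\<Sum>i<k. ?f (i + k)) = (\<Sum>i<k. ?f i)" by simp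
    moreover have "(\<Sum>i<k + n. g i) = (\<Sum>i<k. g i) + (\<Sum>i<n. g (i + k))" for n and g :: "nat \<Rightarrow> nat"
      by (induction n) (auto simp: add.commute)
    from this[of ?f k] have "(\<Sum>i<2 * k. ?f i) = (\<Sum>i<k. ?f i) + (\<Sum>i<k. ?f (i + k))"
      by (simp only: mult_2)
    ultimately have "even (\<Sum>i<2 * k. ?f i)" by simp
    then show ?thesis
      using True relation[OF s t k] p x s t by (simp add: refl_act_power)
  next
    case False
    have "((refl_act s \<circ> refl_act t) ^^ j) (r, e) = (r, e)" for j
      using False by (induction j) (auto simp: refl_act_def)
    then show ?thesis using x by simp
  qed
qed

lemma refl_act_carrier:
  "r \<in> carrier W \<Longrightarrow> refl_act s (r, e) = (s \<otimes> r \<otimes> s, e \<noteq> (r = s))"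
  by (simp add: refl_act_def)

lemma fst_foldr_refl_act:
  assumes "set ss \<subseteq> S" "r \<in> carrier W"
  shows "fst (foldr refl_act ss (r, e)) = wprod W ss \<otimes> r \<otimes> inv (wprod W ss)"
  using assms(1)
proof (induction ss)
  case (Cons a ss)
  then obtain b where b: "foldr refl_act ss (r, e) = (wprod W ss \<otimes> r \<otimes> inv (wprod W ss), b)"
    by (metis list.set_intros(2) prod.collapse subset_code(1))
  have "wprod W ss \<in> carrier W" "a \<in> S" using Cons.prems by auto
  then show ?case using assms(2)
    by (simp add: b refl_act_carrier inv_mult_group m_assoc)
qed (use assms in simp)

lemma foldr_refl_act_Cons:
  assumes "set (a # ss) \<subseteq> S" "r \<in> carrier W"
  shows "snd (foldr refl_act (a # ss) (r, e)) =
    (snd (foldr refl_act ss (r, e)) \<noteq> (wprod W ss \<otimes> r \<otimes> inv (wprod W ss) = a))"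
proof -
  obtain b where b: "foldr refl_act ss (r, e) = (wprod W ss \<otimes> r \<otimes> inv (wprod W ss), b)"
    using fst_foldr_refl_act[of ss r e] assms by (metis list.set_intros(2) prod.collapse subset_code(1))
  have "wprod W ss \<in> carrier W" using assms by auto
  then show ?thesis using assms by (simp add: b refl_act_carrier)
qed

lemma snd_foldr_refl_act_flip:
  assumes "set ss \<subseteq> S" "r \<in> carrier W"
  shows "snd (foldr refl_act ss (r, \<not> e)) \<longleftrightarrow> \<not> snd (foldr refl_act ss (r, e))"
  using assms(1)
proof (induction ss)
  case (Cons a ss)
  then show ?case using assms(2) by (auto simp only: foldr_refl_act_Cons) auto
qed simp

text \<open>
  A sign change must occur at some letter \<open>a\<close>. If \<open>v\<close> is the part of the word after it,
  then \<open>v r v\<inverse> = a\<close>, that is, \<open>v r = a v\<close>; so multiplying by \<open>r\<close> on the right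
  cancels this letter.
\<close>

lemma delete_letter:
  assumes "set ss \<subseteq> S" "r \<in> carrier W" "snd (foldr refl_act ss (r, e)) \<noteq> e"
  shows "\<exists>xs a ys. ss = xs @ a # ys \<and> wprod W ss \<otimes> r = wprod W (xs @ ys)"
  using assms(1,3)
proof (induction ss)
  case (Cons a ss)
  show ?case
  proof (cases "snd (foldr refl_act ss (r, e)) \<noteq> e")
    case True
    with Cons obtain xs b ys where ss: "ss = xs @ b # ys" and eq: "wprod W ss \<otimes> r = wprod W (xs @ ys)"
      by auto
    have "wprod W (a # ss) \<otimes> r = a \<otimes> (wprod W ss \<otimes> r)"
      using Cons.prems assms(2) by (auto simp: m_assoc)
    also have "\<dots> = wprod W ((a # xs) @ ys)" using eq by simp
    finally show ?thesis using ss by (metis append_Cons)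
  next
    case False
    have closed: "wprod W ss \<in> carrier W" "a \<in> S" using Cons.prems by auto
    have "wprod W ss \<otimes> r \<otimes> inv (wprod W ss) = a"
      using False Cons.prems assms(2) by (auto simp only: foldr_refl_act_Cons)
    then have "wprod W ss \<otimes> r = a \<otimes> wprod W ss"
      using closed assms(2) by (metis S_closed inv_solve_right' m_closed)
    then have "wprod W (a # ss) \<otimes> r = wprod W ([] @ ss)"
      using closed assms(2) by (simp add: m_assoc)
    then show ?thesis by (metis append_Nil)
  qed
qed simp

text \<open>
  If the word for \<open>w\<close> does not change the sign of \<open>s\<close>, then a word for \<open>w s\<close> does,
  since the additional letter \<open>s\<close> contributes one flip. Deleting a letter from a reduced word
  for \<open>w s\<close> then gives a word for \<open>w\<close> that is too short.
\<close>

lemma exchange: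
  assumes ss: "set ss \<subseteq> S" and s: "s \<in> S"
    and less: "len (wprod W ss \<otimes> s) < len (wprod W ss)"
  shows "\<exists>xs a ys. ss = xs @ a # ys \<and> wprod W ss \<otimes> s = wprod W (xs @ ys)"
proof (rule delete_letter)
  show "snd (foldr refl_act ss (s, False)) \<noteq> False"
  proof
    assume even: "snd (foldr refl_act ss (s, False)) = False"
    obtain rs where rs: "reduced rs" and rs_eq: "wprod W rs = wprod W ss \<otimes> s"
      using reduced_word[of "wprod W ss \<otimes> s"] ss s by auto
    have rsS: "set rs \<subseteq> S" using rs by (simp add: reduced_def)
    have "foldr refl_act rs = foldr refl_act (ss @ [s])"
      by (rule action_well_defined) (use refl_act_relation rsS ss s rs_eq word_append in auto)
    then have "snd (foldr refl_act rs (s, False)) = snd (foldr refl_act ss (s, True))"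
      using s by (simp add: refl_act_def)
    also have "\<dots> = True"
      using even snd_foldr_refl_act_flip[OF ss, of s False] s by simp
    finally obtain xs a ys where del: "rs = xs @ a # ys" "wprod W rs \<otimes> s = wprod W (xs @ ys)"
      using delete_letter[OF rsS, of s False] s by auto
    have "wprod W ss = wprod W (xs @ ys)"
      using del(2) rs_eq ss s by (simp add: m_assoc)
    then have "len (wprod W ss) < length rs"
      using len_le[of "xs @ ys"] del(1) rsS by auto
    then show False using less rs rs_eq by (simp add: reduced_def)
  qed
qed (use ss s in auto)


section \<open>Longest elements of finite parabolic subgroups\<close>

lemma reduced_appendD:
  assumes "reduced (us @ vs)"
  shows "reduced us" "reduced vs"
proof -
  have S: "set us \<subseteq> S" "set vs \<subseteq> S" using assms by (auto simp: reduced_def)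
  have "length us + length vs = len (wprod W us \<otimes> wprod W vs)"
    using assms S by (simp add: reduced_def word_append)
  also have "\<dots> \<le> len (wprod W us) + len (wprod W vs)"
    using S by (simp add: len_mult_le)
  finally show "reduced us" "reduced vs"
    using S len_le[of us] len_le[of vs] by (auto simp: reduced_def)
qed

lemma generate_subset_carrier: "X \<subseteq> S \<Longrightarrow> generate W X \<subseteq> carrier W"
  using generate_incl S_carrier by blast

lemma generate_closed: "X \<subseteq> S \<Longrightarrow> w \<in> generate W X \<Longrightarrow> w \<in> carrier W"
  using generate_subset_carrier by blast

text \<open>
  Length with respect to \<open>S\<close> and length with respect to \<open>X\<close> agree on the subgroup
  generated by \<open>X\<close>: a word is built up letter by letter, and whenever it stops being reduced
  the exchange condition shortens it by deleting letters only.
\<close>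

lemma reduced_word_parabolic:
  assumes X: "X \<subseteq> S" and w: "w \<in> generate W X"
  shows "\<exists>rs. reduced rs \<and> set rs \<subseteq> X \<and> wprod W rs = w"
proof -
  have "\<exists>rs. reduced rs \<and> set rs \<subseteq> X \<and> wprod W rs = wprod W ss" if "set ss \<subseteq> X" for ss
    using that
  proof (induction ss rule: rev_induct)
    case Nil
    show ?case using len_le[of "[]"] by (intro exI[of _ "[]"]) (simp add: reduced_def)
  next
    case (snoc s ss)
    then obtain rs where rs: "reduced rs" "set rs \<subseteq> X" "wprod W rs = wprod W ss" by auto
    have s: "s \<in> X" "s \<in> S" and ss: "set ss \<subseteq> S" using snoc.prems X by auto
    have eq: "wprod W (ss @ [s]) = wprod W rs \<otimes> s"
      using s ss rs by (simp add: word_append)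
    have rs_closed: "wprod W rs \<in> carrier W" using rs ss by simp
    show ?case
    proof (cases "len (wprod W rs \<otimes> s) \<le> len (wprod W rs)")
      case True
      then have "len (wprod W rs \<otimes> s) < len (wprod W rs)"
        using len_mult_generator_less rs_closed s by blast
      then obtain xs a ys where del: "rs = xs @ a # ys" "wprod W rs \<otimes> s = wprod W (xs @ ys)"
        using exchange[of rs s] rs s by (auto simp: reduced_def)
      have "len (wprod W rs) \<le> len (wprod W rs \<otimes> s) + 1"
        using len_mult_le[of "wprod W rs \<otimes> s" s] len_generator_le[of s] s rs_closed
        by (simp add: m_assoc)
      then have "reduced (xs @ ys)"
        using del rs len_le[of "xs @ ys"] by (auto simp: reduced_def)
      then show ?thesis using del rs eq by (intro exI[of _ "xs @ ys"]) auto
    next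
      case False
      then have "reduced (rs @ [s])"
        using rs s ss len_le[of "rs @ [s]"] by (auto simp: reduced_def word_append)
      then show ?thesis using rs s ss eq
        by (intro exI[of _ "rs @ [s]"]) (auto simp: reduced_def word_append)
    qed
  qed
  then show ?thesis using generate_word[OF w X] by blast
qed

abbreviation is_longest :: "'a set \<Rightarrow> 'a \<Rightarrow> bool" where
  "is_longest X \<equiv> is_arg_max len (\<lambda>w. w \<in> generate W X)"

text \<open>
  Multiplying a longest element \<open>w\<close> by the next letter \<open>x\<close> makes it shorter, so exchange
  deletes a letter from a word \<open>rs @ ss\<close> for \<open>w\<close>. The deleted letter cannot belong to
  \<open>ss\<close>, because \<open>ss @ [x]\<close> is reduced; it is taken from \<open>rs\<close>, and moving \<open>x\<close> to the
  end extends the suffix without changing the total length.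
\<close>

lemma longest_suffix:
  assumes X: "X \<subseteq> S" and w: "is_longest X w" and ss: "set ss \<subseteq> X" "reduced ss"
  shows "\<exists>rs. set rs \<subseteq> X \<and> reduced (rs @ ss) \<and> wprod W (rs @ ss) = w"
  using ss
proof (induction ss rule: rev_induct)
  case Nil
  then show ?case using reduced_word_parabolic[OF X, of w] w by (auto simp: is_arg_max_def)
next
  case (snoc x ss)
  then obtain rs where rs: "set rs \<subseteq> X" "reduced (rs @ ss)" "wprod W (rs @ ss) = w"
    using reduced_appendD(1) by fastforce
  have x: "x \<in> X" "x \<in> S" and ssS: "set ss \<subseteq> S" and rsS: "set rs \<subseteq> S"
    and wW: "w \<in> generate W X" "w \<in> carrier W"
    using snoc.prems X rs w generate_closed by (auto simp: is_arg_max_def)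
  have "w \<otimes> x \<in> generate W X"
    using wW x by (auto intro: generate.intros)
  then have "len (w \<otimes> x) < len w"
    using w x wW len_mult_generator_less by (auto simp: is_arg_max_linorder)
  then obtain xs a ys where del: "rs @ ss = xs @ a # ys" "w \<otimes> x = wprod W (xs @ ys)"
    using exchange[of "rs @ ss" x] rs x ssS rsS by auto
  consider zs where "rs = xs @ a # zs" "ys = zs @ ss" | zs where "xs = rs @ zs" "ss = zs @ a # ys"
    using del(1) by (auto simp: append_eq_append_conv2 append_eq_Cons_conv)
  then show ?case
  proof cases
    case (1 zs)
    have S: "set xs \<subseteq> S" "set zs \<subseteq> S" using 1 rsS by auto
    have "w = wprod W (xs @ ys) \<otimes> x"
      unfolding del(2)[symmetric] using wW x by (simp add: m_assoc)
    also have "\<dots> = wprod W ((xs @ zs) @ (ss @ [x]))"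
      using 1 S ssS x by (simp add: word_append m_assoc)
    finally have "wprod W ((xs @ zs) @ (ss @ [x])) = w" ..
    moreover have "reduced ((xs @ zs) @ (ss @ [x]))"
      using rs 1 S ssS x calculation by (simp add: reduced_def)
    ultimately show ?thesis using rs 1 by (intro exI[of _ "xs @ zs"]) auto
  next
    case (2 zs)
    have S: "set zs \<subseteq> S" "set ys \<subseteq> S" using 2 ssS by auto
    have "wprod W rs \<otimes> wprod W (ss @ [x]) = wprod W (rs @ ss) \<otimes> x"
      using rsS ssS x by (simp add: word_append m_assoc)
    also have "\<dots> = wprod W rs \<otimes> wprod W (zs @ ys)"
      using del(2) rs(3) 2 rsS S by (simp add: word_append)
    finally have "wprod W (ss @ [x]) = wprod W (zs @ ys)"
      using Units_l_cancel[of "wprod W rs" "wprod W (ss @ [x])" "wprod W (zs @ ys)"] rsS ssS S x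
      by simp
    then have "len (wprod W (ss @ [x])) \<le> length (zs @ ys)"
      using len_le[of "zs @ ys"] S by simp
    then show ?thesis using snoc.prems 2 by (simp add: reduced_def)
  qed
qed

lemma longest_factor:
  assumes X: "X \<subseteq> S" and w: "is_longest X w" and v: "v \<in> generate W X"
  shows "\<exists>u \<in> generate W X. w = u \<otimes> v \<and> len w = len u + len v"
proof -
  obtain ss where ss: "reduced ss" "set ss \<subseteq> X" "wprod W ss = v"
    using reduced_word_parabolic[OF X v] by blast
  then obtain rs where rs: "set rs \<subseteq> X" "reduced (rs @ ss)" "wprod W (rs @ ss) = w"
    using longest_suffix[OF X w] by blast
  have "reduced rs" using rs reduced_appendD by blast
  then show ?thesis using rs ss word_generate[of rs X]
    by (intro bexI[of _ "wprod W rs"]) (auto simp: reduced_def word_append)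
qed

lemma len_0_D:
  assumes "w \<in> carrier W" "len w = 0"
  shows "w = \<one>"
  using reduced_word[OF assms(1)] assms(2) by (auto simp: reduced_def)

text \<open>
  Each longest element is a right factor of the other, and no length is left for the
  complementary factor.
\<close>

lemma longest_unique:
  assumes X: "X \<subseteq> S" and w: "is_longest X w" and v: "is_longest X v"
  shows "v = w"
proof -
  have "v \<in> generate W X" "len w \<le> len v"
    using w v by (auto simp: is_arg_max_linorder)
  then obtain u where "u \<in> generate W X" "w = u \<otimes> v" "len w = len u + len v"
    using longest_factor[OF X w] by blast
  then show ?thesis
    using \<open>len w \<le> len v\<close> \<open>v \<in> generate W X\<close> len_0_D[of u] generate_closed[OF X] by auto
qed

lemma longest_element_eqI:
  assumes "X \<subseteq> S" "is_longest X w"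
  shows "longest_element W S X = w"
  unfolding longest_element_def
  by (rule the_equality[of _ w]) (use assms longest_unique in auto)

lemma longest_element_is_longest:
  assumes X: "X \<subseteq> S" and fin: "spherical_subset W X"
  shows "is_longest X (longest_element W S X)"
proof -
  have fin: "finite (generate W X)" using fin by (simp add: spherical_subset_def)
  have ne: "generate W X \<noteq> {}" using generate.one by blast
  have "Max (len ` generate W X) \<in> len ` generate W X" using fin ne by simp
  then obtain w where "w \<in> generate W X" "len w = Max (len ` generate W X)"
    by (metis imageE)
  then have w: "is_longest X w"
    using fin by (simp add: is_arg_max_linorder)
  then show ?thesis using longest_element_eqI[OF X w] by simp
qed

context
  fixes X
  assumes X: "X \<subseteq> S" and fin: "spherical_subset W X"
begin

lemma longest_generate: "longest_element W S X \<in> generate W X"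
  using longest_element_is_longest[OF X fin] by (simp add: is_arg_max_def)

lemma longest_closed [simp]: "longest_element W S X \<in> carrier W"
  using longest_generate X generate_closed by blast

text \<open>
  Inversion preserves length and the subgroup, so this is uniqueness.
\<close>

lemma longest_inv: "inv (longest_element W S X) = longest_element W S X"
proof (rule longest_unique[OF X longest_element_is_longest[OF X fin]])
  have "inv (longest_element W S X) \<in> generate W X"
    using longest_generate X S_carrier by (simp add: generate_m_inv_closed)
  then show "is_longest X (inv (longest_element W S X))"
    using longest_element_is_longest[OF X fin] by (simp add: is_arg_max_linorder len_inv)
qed

lemma longest_square: "longest_element W S X \<otimes> longest_element W S X = \<one>"
  using r_inv[OF longest_closed] longest_inv by simp

end

definition lconj :: "'a set \<Rightarrow> 'a \<Rightarrow> 'a" where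
  "lconj X y = longest_element W S X \<otimes> y \<otimes> inv (longest_element W S X)"

lemma longest_conj_image: "longest_conj W S X Y = lconj X ` Y"
  by (simp add: longest_conj_def lconj_def)

context
  fixes X
  assumes X: "X \<subseteq> S" and fin: "spherical_subset W X"
begin

lemma lconj_closed [simp]: "y \<in> carrier W \<Longrightarrow> lconj X y \<in> carrier W"
  by (simp add: lconj_def longest_closed[OF X fin])

lemma lconj_mult: "y \<in> carrier W \<Longrightarrow> z \<in> carrier W \<Longrightarrow> lconj X (y \<otimes> z) = lconj X y \<otimes> lconj X z"
  using longest_closed[OF X fin] by (simp add: lconj_def m_assoc inv_solve_left)

lemma lconj_lconj: "y \<in> carrier W \<Longrightarrow> lconj X (lconj X y) = y"
  using longest_closed[OF X fin] longest_inv[OF X fin] longest_square[OF X fin]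
  by (simp add: lconj_def m_assoc) (simp add: m_assoc[symmetric])

lemma lconj_hom: "group_hom W W (lconj X)"
  by unfold_locales (auto simp: hom_def lconj_mult)

text \<open>
  Write \<open>w = u (w s)\<close>, so that \<open>u = w s w\<inverse>\<close>. Since lengths add in such a factorisation, and
  also in \<open>w = (w s) s\<close>, the lengths of \<open>u\<close> and \<open>s\<close> agree; hence \<open>u\<close> is a generator in
  \<open>X\<close>.
\<close>

lemma lconj_generator:
  assumes s: "s \<in> X"
  shows "lconj X s \<in> X"
proof -
  let ?w = "longest_element W S X"
  note longest = longest_element_is_longest[OF X fin]
  have sS: "s \<in> S" using s X by blast
  have sW: "s \<in> generate W X" using s by (rule generate.incl)
  have w: "?w \<in> carrier W" by (rule longest_closed[OF X fin])
  have ws: "?w \<otimes> s \<in> generate W X"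
    using longest_generate[OF X fin] sW by (rule generate.eng)
  obtain v where v: "v \<in> generate W X" "?w = v \<otimes> s" "len ?w = len v + len s"
    using longest_factor[OF X longest sW] by blast
  have "v = ?w \<otimes> s" using v sS generate_closed[OF X] by (simp add: m_assoc)
  obtain u where u: "u \<in> generate W X" "?w = u \<otimes> (?w \<otimes> s)" "len ?w = len u + len (?w \<otimes> s)"
    using longest_factor[OF X longest ws] by blast
  have uW: "u \<in> carrier W" using u(1) generate_closed[OF X] by blast
  have "u = ?w \<otimes> inv (?w \<otimes> s)"
    by (rule inv_solve_right[THEN iffD2]) (use uW w sS u(2) in auto)
  then have conj: "u = lconj X s"
    using w sS by (simp add: lconj_def inv_mult_group m_assoc)
  have "len u \<le> 1"
    using u(3) v(3) \<open>v = ?w \<otimes> s\<close> len_generator_le[OF sS] by simp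
  moreover obtain rs where "reduced rs" "set rs \<subseteq> X" "wprod W rs = u"
    using reduced_word_parabolic[OF X u(1)] by blast
  ultimately consider "u = \<one>" | r where "rs = [r]" "r \<in> X" "u = r \<otimes> \<one>"
    by (cases rs) (auto simp: reduced_def)
  then show ?thesis
  proof cases
    \<comment> \<open>If the conjugate is trivial then so is \<open>s\<close>, and the claim becomes \<open>s \<in> X\<close>.\<close>
    case 1
    then have "s = lconj X \<one>" using conj lconj_lconj[of s] sS by simp
    then have "s = \<one>" using w by (simp add: lconj_def)
    then show ?thesis using 1 conj s by simp
  next
    case 2
    then show ?thesis using conj X by auto
  qed
qed

lemma lconj_image: "lconj X ` X = X"
proof
  show "lconj X ` X \<subseteq> X" using lconj_generator by blast
  show "X \<subseteq> lconj X ` X"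
  proof
    fix s assume "s \<in> X"
    then show "s \<in> lconj X ` X"
      using lconj_generator lconj_lconj[of s] X by (metis S_closed image_eqI subsetD)
  qed
qed

lemma inj_on_lconj: "inj_on (lconj X) (carrier W)"
  by (rule inj_on_inverseI[of _ "lconj X"]) (rule lconj_lconj)

lemma lconj_word: "set ss \<subseteq> S \<Longrightarrow> wprod W (map (lconj X) ss) = lconj X (wprod W ss)"
  using group_hom.hom_one[OF lconj_hom] by (induction ss) (auto simp: lconj_mult)

text \<open>
  Conjugating a reduced word letter by letter gives a word in \<open>X\<close> of the same length, so
  lengths do not increase; the map is an involution, so they do not decrease either.
\<close>

lemma len_lconj:
  assumes "v \<in> generate W X"
  shows "len (lconj X v) = len v"
proof -
  have le: "len (lconj X u) \<le> len u" if u: "u \<in> generate W X" for u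
  proof -
    obtain rs where rs: "reduced rs" "set rs \<subseteq> X" "wprod W rs = u"
      using reduced_word_parabolic[OF X u] by blast
    then have "set (map (lconj X) rs) \<subseteq> S" using lconj_generator X by auto
    then show ?thesis
      using len_le[of "map (lconj X) rs"] lconj_word[of rs] rs by (simp add: reduced_def)
  qed
  have "lconj X ` generate W X = generate W (lconj X ` X)"
    using group_hom.generate_img[OF lconj_hom, of X] X S_carrier by auto
  then have "lconj X v \<in> generate W X"
    using assms lconj_image by auto
  then show ?thesis
    using le[of v] le[of "lconj X v"] assms lconj_lconj[of v] generate_closed[OF X] by simp
qed

lemma longest_element_lconj:
  assumes Y: "Y \<subseteq> X"
  shows "longest_element W S (lconj X ` Y) = lconj X (longest_element W S Y)"
proof (rule longest_element_eqI)
  have gen: "generate W (lconj X ` Y) = lconj X ` generate W Y"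
    using group_hom.generate_img[OF lconj_hom, of Y] X Y S_carrier by auto
  have sub: "generate W Y \<subseteq> generate W X" using Y by (rule mono_generate)
  have YS: "Y \<subseteq> S" using X Y by blast
  have "spherical_subset W Y"
    using fin sub by (auto simp: spherical_subset_def finite_subset)
  then have "is_longest Y (longest_element W S Y)"
    using YS longest_element_is_longest by blast
  then show "is_longest (lconj X ` Y) (lconj X (longest_element W S Y))"
    unfolding gen by (auto simp: is_arg_max_linorder len_lconj subsetD[OF sub])
  show "lconj X ` Y \<subseteq> S" using Y X lconj_generator by blast
qed

end


section \<open>Edges of the Coxeter graph are non-commuting pairs\<close>

text \<open>
  The Gram matrix, multiplied by \<open>-2\<close>, of the geometric representation. The entry for an infinite
  label only has to be positive.
\<close>

definition bond :: "'a \<Rightarrow> 'a \<Rightarrow> real" where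
  "bond s t = (if s = t then -2 else case m s t of enat k \<Rightarrow> 2 * cos (pi / real k) | \<infinity> \<Rightarrow> 2)"

text \<open>
  The reflection \<open>v \<mapsto> v - 2 B(\<alpha>\<^sub>s, v) \<alpha>\<^sub>s\<close> as it acts on linear forms, where a form is given
  by its values on the simple roots. Forms are arbitrary functions even if \<open>S\<close> is infinite,
  whereas vectors would have to be finitely supported.
\<close>

definition geo_act :: "'a \<Rightarrow> ('a \<Rightarrow> real) \<Rightarrow> 'a \<Rightarrow> real" where
  "geo_act s f = (\<lambda>u. f u + bond s u * f s)"

lemma bond_sym: "s \<in> S \<Longrightarrow> t \<in> S \<Longrightarrow> bond s t = bond t s"
  using matrix_sym[of s t] by (simp add: bond_def)

text \<open>
  The product \<open>s t\<close> transforms the pair of values at \<open>s\<close> and \<open>t\<close> by a matrix conjugate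
  to the rotation through \<open>2 \<theta>\<close>. The two coefficients are sums along the orbit of this
  rotation, telescoped; they vanish as soon as \<open>2 j \<theta>\<close> is a full turn.
\<close>

lemma geo_act_power:
  assumes st: "bond s t = 2 * cos \<theta>" "bond t s = 2 * cos \<theta>" "sin \<theta> \<noteq> 0"
  shows "((geo_act s \<circ> geo_act t) ^^ j) f = (\<lambda>u. f u
     + (f s * (1 - cos (2 * real j * \<theta>)) + f t * (cos \<theta> - cos (2 * real j * \<theta> + \<theta>))) / (2 * (sin \<theta>)\<^sup>2) * bond s u
     + (f s * (cos \<theta> - cos (2 * real j * \<theta> - \<theta>)) + f t * (1 - cos (2 * real j * \<theta>))) / (2 * (sin \<theta>)\<^sup>2) * bond t u)"
proof (induction j)
  case 0
  then show ?case by simp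
next
  case (Suc j)
  \<comment> \<open>In terms of these four numbers the induction step is a polynomial identity modulo \<open>c\<^sup>2 + d\<^sup>2 = 1\<close>.\<close>
  define C D c d where CD: "C = cos (2 * real j * \<theta>)" "D = sin (2 * real j * \<theta>)" "c = cos \<theta>" "d = sin \<theta>"
  have cos_minus: "cos (2 * real j * \<theta> - \<theta>) = C * c + D * d"
    and cos_plus: "cos (2 * real j * \<theta> + \<theta>) = C * c - D * d"
    by (simp_all add: CD cos_diff cos_add)
  have sin_plus: "sin (2 * real j * \<theta> + \<theta>) = D * c + C * d"
    by (simp add: CD sin_add)
  have "2 * real (Suc j) * \<theta> - \<theta> = 2 * real j * \<theta> + \<theta>" "2 * real (Suc j) * \<theta> = (2 * real j * \<theta> + \<theta>) + \<theta>"
    by (simp_all add: algebra_simps)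
  then have Suc1: "cos (2 * real (Suc j) * \<theta> - \<theta>) = C * c - D * d"
    and Suc2: "cos (2 * real (Suc j) * \<theta>) = (C * c - D * d) * c - (D * c + C * d) * d"
    and Suc3: "cos (2 * real (Suc j) * \<theta> + \<theta>)
      = ((C * c - D * d) * c - (D * c + C * d) * d) * c - ((D * c + C * d) * c + (C * c - D * d) * d) * d"
    by (simp_all only: cos_plus sin_plus cos_add[of "2 * real j * \<theta> + \<theta>" \<theta>] sin_add[of "2 * real j * \<theta> + \<theta>" \<theta>]
        cos_add[of "2 * real j * \<theta> + \<theta> + \<theta>" \<theta>] CD(3,4))
  have d: "d \<noteq> 0" and unit: "c\<^sup>2 = 1 - d\<^sup>2" using st(3) by (simp_all add: CD cos_squared_eq)
  have ss: "bond s s = -2" "bond t t = -2" by (simp_all add: bond_def)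
  define A where "A = (f s * (1 - C) + f t * (c - (C * c - D * d))) / (2 * d\<^sup>2)"
  define B where "B = (f s * (c - (C * c + D * d)) + f t * (1 - C)) / (2 * d\<^sup>2)"
  have A: "2 * d\<^sup>2 * A = f s * (1 - C) + f t * (c - (C * c - D * d))"
    and B: "2 * d\<^sup>2 * B = f s * (c - (C * c + D * d)) + f t * (1 - C)"
    using d by (simp_all add: A_def B_def)
  \<comment> \<open>The values at \<open>t\<close> and \<open>s\<close> of the function reached after \<open>j\<close> steps.\<close>
  let ?b = "f t + A * (2 * c) - 2 * B"
  let ?a = "f s - 2 * A + B * (2 * c)"
  have B': "B + ?b = (f s * (c - (C * c - D * d))
      + f t * (1 - ((C * c - D * d) * c - (D * c + C * d) * d))) / (2 * d\<^sup>2)"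
  proof -
    let ?R = "f s * (c - (C * c - D * d)) + f t * (1 - ((C * c - D * d) * c - (D * c + C * d) * d))"
    have "2 * d\<^sup>2 * (B + ?b) = 2 * d\<^sup>2 * f t + 2 * c * (2 * d\<^sup>2 * A) - 2 * d\<^sup>2 * B"
      by (simp add: algebra_simps)
    moreover have "2 * d\<^sup>2 * f t + 2 * c * (2 * d\<^sup>2 * A) - 2 * d\<^sup>2 * B - ?R = f t * (2 - C) * (c\<^sup>2 + d\<^sup>2 - 1)"
      unfolding A B by (simp add: algebra_simps power2_eq_square)
    moreover have "c\<^sup>2 + d\<^sup>2 - 1 = 0" using unit by simp
    ultimately have "2 * d\<^sup>2 * (B + ?b) = ?R" by simp
    then show ?thesis using d by (simp add: field_simps)
  qed
  have A': "A + (?a + 2 * c * ?b) = (f s * (1 - ((C * c - D * d) * c - (D * c + C * d) * d))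
      + f t * (c - (((C * c - D * d) * c - (D * c + C * d) * d) * c - ((D * c + C * d) * c + (C * c - D * d) * d) * d)))
      / (2 * d\<^sup>2)"
  proof -
    let ?R = "f s * (1 - ((C * c - D * d) * c - (D * c + C * d) * d))
      + f t * (c - (((C * c - D * d) * c - (D * c + C * d) * d) * c - ((D * c + C * d) * c + (C * c - D * d) * d) * d))"
    have "2 * d\<^sup>2 * (A + (?a + 2 * c * ?b)) = 2 * d\<^sup>2 * f s + 4 * c * d\<^sup>2 * f t
        + (4 * c\<^sup>2 - 1) * (2 * d\<^sup>2 * A) - 2 * c * (2 * d\<^sup>2 * B)"
      by (simp add: algebra_simps power2_eq_square)
    moreover have "2 * d\<^sup>2 * f s + 4 * c * d\<^sup>2 * f t
        + (4 * c\<^sup>2 - 1) * (2 * d\<^sup>2 * A) - 2 * c * (2 * d\<^sup>2 * B) - ?R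
        = (f s * (2 - C) + f t * (4 * c - 3 * c * C + d * D)) * (c\<^sup>2 + d\<^sup>2 - 1)"
      unfolding A B by (simp add: algebra_simps power2_eq_square)
    moreover have "c\<^sup>2 + d\<^sup>2 - 1 = 0" using unit by simp
    ultimately have "2 * d\<^sup>2 * (A + (?a + 2 * c * ?b)) = ?R" by simp
    then show ?thesis using d by (simp add: field_simps)
  qed
  have IH: "((geo_act s \<circ> geo_act t) ^^ j) f = (\<lambda>u. f u + A * bond s u + B * bond t u)"
    unfolding Suc A_def B_def cos_minus cos_plus CD[symmetric] ..
  have "((geo_act s \<circ> geo_act t) ^^ Suc j) f = geo_act s (geo_act t (\<lambda>u. f u + A * bond s u + B * bond t u))"
    using IH by simp
  also have "\<dots> = (\<lambda>u. f u + (A + (?a + 2 * c * ?b)) * bond s u + (B + ?b) * bond t u)"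
    using st by (simp add: geo_act_def ss CD[symmetric] fun_eq_iff algebra_simps)
  finally show ?case
    unfolding Suc1 Suc2 Suc3 A' B' CD(3,4)[symmetric] .
qed

lemma geo_act_relation:
  assumes s: "s \<in> S" and t: "t \<in> S" and k: "m s t = enat k"
  shows "(geo_act s \<circ> geo_act t) ^^ k = id"
proof (cases "s = t")
  case True
  then have "k = 1" using k diagonal[OF s] by simp
  then show ?thesis using True by (simp add: geo_act_def bond_def fun_eq_iff)
next
  case False
  have "enat 2 \<le> enat k"
    using matrix_ge_2[OF s t False] k by (simp add: numeral_eq_enat)
  then have k2: "2 \<le> k" by simp
  define \<theta> where "\<theta> = pi / real k"
  have "0 < \<theta>" "\<theta> < pi" using k2 by (auto simp: \<theta>_def field_simps)
  then have "sin \<theta> \<noteq> 0" using sin_gt_zero by fastforce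
  moreover have "bond s t = 2 * cos \<theta>" using False k by (simp add: bond_def \<theta>_def)
  ultimately have power: "((geo_act s \<circ> geo_act t) ^^ k) f = (\<lambda>u. f u
     + (f s * (1 - cos (2 * real k * \<theta>)) + f t * (cos \<theta> - cos (2 * real k * \<theta> + \<theta>))) / (2 * (sin \<theta>)\<^sup>2) * bond s u
     + (f s * (cos \<theta> - cos (2 * real k * \<theta> - \<theta>)) + f t * (1 - cos (2 * real k * \<theta>))) / (2 * (sin \<theta>)\<^sup>2) * bond t u)" for f
    using bond_sym[OF s t] by (intro geo_act_power) auto
  have turn: "2 * real k * \<theta> = 2 * pi" using k2 by (simp add: \<theta>_def)
  show ?thesis
    by (rule ext) (simp add: power turn cos_add cos_diff)
qed

text \<open>
  The two products are told apart by their effect on the indicator function of \<open>t\<close>: the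
  values at \<open>s\<close> differ by \<open>2 (bond s t)\<close>, and \<open>bond s t\<close> is positive once the label
  exceeds \<open>2\<close>.
\<close>

lemma not_commute:
  assumes s: "s \<in> S" and t: "t \<in> S" and "s \<noteq> t" and m3: "3 \<le> m s t"
  shows "s \<otimes> t \<noteq> t \<otimes> s"
proof
  assume comm: "s \<otimes> t = t \<otimes> s"
  have "foldr geo_act [s, t] = foldr geo_act [t, s]"
    by (rule action_well_defined) (use geo_act_relation s t comm in auto)
  then have "geo_act s (geo_act t f) s = geo_act t (geo_act s f) s" for f
    by (simp add: fun_eq_iff)
  from this[of "\<lambda>u. if u = t then 1 else 0"] have "bond s t = 0"
    using \<open>s \<noteq> t\<close> bond_sym[OF s t] by (simp add: geo_act_def bond_def[of s s])
  moreover have "bond s t > 0"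
  proof (cases "m s t")
    case (enat k)
    then have "3 \<le> k" using m3 by (simp add: numeral_eq_enat)
    then have "0 < pi / k" "pi / k < pi / 2" by (auto simp: field_simps)
    then have "cos (pi / k) > 0" by (intro cos_gt_zero) auto
    then show ?thesis using enat \<open>s \<noteq> t\<close> by (simp add: bond_def)
  qed (use \<open>s \<noteq> t\<close> in \<open>simp add: bond_def\<close>)
  ultimately show False by simp
qed

text \<open>
  This characterises the edges by the group structure alone, which makes them visibly invariant
  under conjugation.
\<close>

lemma coxeter_edge_iff:
  assumes s: "s \<in> S" and t: "t \<in> S"
  shows "{s, t} \<in> coxeter_edges S m \<longleftrightarrow> s \<otimes> t \<noteq> t \<otimes> s"
proof
  assume "{s, t} \<in> coxeter_edges S m"
  then have "s \<noteq> t" "3 \<le> m s t"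
    using matrix_sym by (auto simp: coxeter_edges_def doubleton_eq_iff)
  then show "s \<otimes> t \<noteq> t \<otimes> s" using not_commute s t by blast
next
  assume nc: "s \<otimes> t \<noteq> t \<otimes> s"
  have "m s t \<noteq> enat 2"
  proof
    assume "m s t = enat 2"
    then have "(s \<otimes> t) \<otimes> (s \<otimes> t) = \<one>"
      using relation[OF s t, of 2] s t by (simp add: numeral_2_eq_2 m_assoc)
    then have "s \<otimes> t = inv (s \<otimes> t)" using s t by (simp add: inv_equality)
    also have "\<dots> = t \<otimes> s" using s t by (simp add: inv_mult_group)
    finally show False using nc by blast
  qed
  moreover have "s \<noteq> t" using nc by blast
  moreover have "2 \<le> m s t" using matrix_ge_2 s t \<open>s \<noteq> t\<close> by blast
  ultimately have "3 \<le> m s t"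
    by (cases "m s t") (auto simp: numeral_eq_enat)
  then show "{s, t} \<in> coxeter_edges S m"
    using s t \<open>s \<noteq> t\<close> by (auto simp: coxeter_edges_def)
qed

lemma lconj_edge_iff:
  assumes X: "X \<subseteq> S" "spherical_subset W X" and s: "s \<in> X" and t: "t \<in> X"
  shows "{lconj X s, lconj X t} \<in> coxeter_edges S m \<longleftrightarrow> {s, t} \<in> coxeter_edges S m"
proof -
  have S: "s \<in> S" "t \<in> S" "lconj X s \<in> S" "lconj X t \<in> S"
    using assms lconj_generator[OF X] by auto
  then show ?thesis
    using inj_onD[OF inj_on_lconj[OF X], of "s \<otimes> t" "t \<otimes> s"]
    by (auto simp: coxeter_edge_iff lconj_mult[OF X, symmetric])
qed


section \<open>The trickle structure\<close>

lemma S_fi_D: "X \<in> S_fi W S m \<Longrightarrow> X \<subseteq> S \<and> X \<noteq> {} \<and> spherical_subset W X"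
  by (auto simp: S_fi_def)

lemma disjoint_union_mono:
  "coxeter_disjoint_union S m X Y \<Longrightarrow> X' \<subseteq> X \<Longrightarrow> Y' \<subseteq> Y \<Longrightarrow> coxeter_disjoint_union S m X' Y'"
  unfolding coxeter_disjoint_union_def by blast

lemma disjoint_union_sym:
  "coxeter_disjoint_union S m X Y \<longleftrightarrow> coxeter_disjoint_union S m Y X"
  unfolding coxeter_disjoint_union_def by (metis Int_commute insert_commute)

lemma edge_iff:
  "{X, Y} \<in> coxeter_trickle_edges W S m \<longleftrightarrow>
     X \<in> S_fi W S m \<and> Y \<in> S_fi W S m \<and> X \<noteq> Y \<and>
     (X \<subset> Y \<or> Y \<subset> X \<or> coxeter_disjoint_union S m X Y)"
  unfolding coxeter_trickle_edges_def using disjoint_union_sym by (auto simp: doubleton_eq_iff)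

lemma disjoint_union_incomparable:
  assumes "coxeter_disjoint_union S m X Y" "X \<in> S_fi W S m" "Y \<in> S_fi W S m"
  shows "\<not> X \<subseteq> Y" "\<not> Y \<subseteq> X"
  using assms S_fi_D[of X] S_fi_D[of Y] by (auto simp: coxeter_disjoint_union_def)

lemma star_iff:
  assumes "X \<in> S_fi W S m"
  shows "Y \<in> star (coxeter_trickle_edges W S m) X \<longleftrightarrow>
    Y \<in> S_fi W S m \<and> (Y \<subset> X \<or> X \<subseteq> Y \<or> coxeter_disjoint_union S m X Y)"
  using assms by (auto simp: star_def edge_iff)

context
  fixes X
  assumes X: "X \<in> S_fi W S m"
begin

lemma vertex_spherical: "X \<subseteq> S" "spherical_subset W X"
  using S_fi_D[OF X] by auto

text \<open>
  Conjugation carries paths in the Coxeter graph of \<open>Y\<close> to paths in that of its image.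
\<close>

lemma lconj_image_S_fi:
  assumes Y: "Y \<in> S_fi W S m" "Y \<subseteq> X"
  shows "lconj X ` Y \<in> S_fi W S m"
proof -
  have sub: "lconj X ` Y \<subseteq> X" using lconj_generator[OF vertex_spherical] Y by blast
  have "finite (generate W (lconj X ` Y))"
    using mono_generate[OF sub] vertex_spherical(2) finite_subset by (auto simp: spherical_subset_def)
  moreover have "irreducible_subset S m (lconj X ` Y)"
    unfolding irreducible_subset_def connected_graph_def
  proof (safe)
    fix s t assume st: "s \<in> Y" "t \<in> Y"
    let ?R = "{(a, b). {a, b} \<in> full_edges (coxeter_edges S m) Y}"
    let ?R' = "{(a, b). {a, b} \<in> full_edges (coxeter_edges S m) (lconj X ` Y)}"
    have "(s, t) \<in> ?R\<^sup>*"
      using Y st by (auto simp: S_fi_def irreducible_subset_def connected_graph_def)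
    then show "(lconj X s, lconj X t) \<in> ?R'\<^sup>*"
    proof (induction rule: rtrancl_induct)
      case (step a b)
      then have "(lconj X a, lconj X b) \<in> ?R'"
        using lconj_edge_iff[OF vertex_spherical, of a b] Y(2) by (auto simp: full_edges_def)
      then show ?case using step.IH by (rule rtrancl_into_rtrancl[rotated])
    qed simp
  qed
  ultimately show ?thesis
    using sub vertex_spherical S_fi_D[OF Y(1)] by (auto simp: S_fi_def spherical_subset_def)
qed

lemma lconj_image_image:
  assumes "Y \<subseteq> X"
  shows "lconj X ` lconj X ` Y = Y"
proof -
  have "lconj X ` lconj X ` Y = (\<lambda>y. y) ` Y"
    unfolding image_image using assms vertex_spherical by (intro image_cong) (auto simp: lconj_lconj subset_iff)
  then show ?thesis by simp
qed

lemma lconj_image_psubset: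
  assumes "Y \<subset> X"
  shows "lconj X ` Y \<subset> X"
proof -
  have "lconj X ` Y \<subseteq> X" using assms lconj_generator[OF vertex_spherical] by blast
  moreover have "lconj X ` Y \<noteq> X"
    using assms lconj_image_image[of Y] lconj_image[OF vertex_spherical] by auto
  ultimately show ?thesis by blast
qed

lemma lconj_image_disjoint_union:
  assumes "coxeter_disjoint_union S m Y Z" "Y \<subseteq> X" "Z \<subseteq> X"
  shows "coxeter_disjoint_union S m (lconj X ` Y) (lconj X ` Z)"
proof -
  have "inj_on (lconj X) X"
    using inj_on_lconj[OF vertex_spherical] vertex_spherical(1) S_carrier by (meson inj_on_subset subset_trans)
  then have "lconj X ` Y \<inter> lconj X ` Z = lconj X ` (Y \<inter> Z)"
    using assms by (simp add: inj_on_image_Int)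
  moreover have "{lconj X s, lconj X t} \<notin> coxeter_edges S m" if "s \<in> Y" "t \<in> Z" for s t
    using that assms lconj_edge_iff[OF vertex_spherical, of s t] by (auto simp: coxeter_disjoint_union_def)
  ultimately show ?thesis using assms(1) by (auto simp: coxeter_disjoint_union_def)
qed

abbreviation "\<phi> \<equiv> coxeter_trickle_map W S X"
abbreviation "st \<equiv> star (coxeter_trickle_edges W S m) X"

lemma map_below: "Y \<subset> X \<Longrightarrow> \<phi> Y = lconj X ` Y"
  by (simp add: coxeter_trickle_map_def longest_conj_image)

lemma map_fixed: "\<not> Y \<subset> X \<Longrightarrow> \<phi> Y = Y"
  by (simp add: coxeter_trickle_map_def)

lemma map_star: "Y \<in> st \<Longrightarrow> \<phi> Y \<in> st"
  by (cases "Y \<subset> X")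
    (auto simp: map_below map_fixed star_iff[OF X] lconj_image_S_fi lconj_image_psubset)

lemma map_map: "\<phi> (\<phi> Y) = Y"
  by (cases "Y \<subset> X") (simp_all add: map_below map_fixed lconj_image_psubset lconj_image_image)

text \<open>
  The only case where the two sets are treated differently is \<open>Z \<subset> X \<subseteq> Y\<close>, and then the
  image of \<open>Z\<close> stays inside \<open>X\<close>.
\<close>

lemma map_mono:
  assumes "Y \<in> st" "Z \<in> st" "Z \<subseteq> Y"
  shows "\<phi> Z \<subseteq> \<phi> Y"
proof (cases "Z \<subset> X \<and> \<not> Y \<subset> X")
  case True
  have "\<not> coxeter_disjoint_union S m X Y"
    using True assms S_fi_D[of Z] by (auto simp: star_iff[OF X] coxeter_disjoint_union_def)
  then have "X \<subseteq> Y" using True assms by (auto simp: star_iff[OF X])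
  then show ?thesis using True lconj_image_psubset[of Z] by (simp add: map_below map_fixed)
next
  case False
  then consider "Z \<subset> X" "Y \<subset> X" | "\<not> Z \<subset> X" "\<not> Y \<subset> X" using assms(3) by blast
  then show ?thesis by cases (use assms(3) in \<open>simp_all add: map_below map_fixed image_mono\<close>)
qed

text \<open>
  If \<open>Y \<subset> X\<close> and \<open>Z\<close> is not below \<open>X\<close>, then \<open>Z\<close> must be disjoint from all of \<open>X\<close>, so it is
  disjoint from the image of \<open>Y\<close> as well.
\<close>

lemma map_disjoint_union:
  assumes Y: "Y \<in> st" and Z: "Z \<in> st" and disj: "coxeter_disjoint_union S m Y Z"
  shows "coxeter_disjoint_union S m (\<phi> Y) (\<phi> Z)"
proof -
  have mixed: "coxeter_disjoint_union S m (\<phi> Y) (\<phi> Z)"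
    if Y: "Y \<in> st" "Y \<subset> X" and Z: "Z \<in> st" "\<not> Z \<subset> X"
      and disj: "coxeter_disjoint_union S m Y Z" for Y Z
  proof -
    have "\<not> X \<subseteq> Z"
      using Y disj disjoint_union_incomparable(1)[OF disj] Y Z by (auto simp: star_iff[OF X])
    then have "coxeter_disjoint_union S m X Z" using Z by (auto simp: star_iff[OF X])
    then show ?thesis
      using Y(2) Z(2) lconj_image_psubset[OF Y(2)] by (auto simp: map_below map_fixed intro: disjoint_union_mono)
  qed
  consider "Y \<subset> X" "Z \<subset> X" | "Y \<subset> X" "\<not> Z \<subset> X" | "\<not> Y \<subset> X" "Z \<subset> X" | "\<not> Y \<subset> X" "\<not> Z \<subset> X"
    by blast
  then show ?thesis
  proof cases
    case 1
    then show ?thesis using lconj_image_disjoint_union[OF disj] by (simp add: map_below psubset_imp_subset)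
  next
    case 2
    then show ?thesis using mixed Y Z disj by blast
  next
    case 3
    then show ?thesis using mixed Y Z disj disjoint_union_sym by blast
  next
    case 4
    then show ?thesis using disj by (simp add: map_fixed)
  qed
qed

text \<open>
  Preservation in one direction suffices for an automorphism, because the map is its own
  inverse.
\<close>

lemma map_edge:
  assumes Y: "Y \<in> st" and Z: "Z \<in> st" and e: "{Y, Z} \<in> coxeter_trickle_edges W S m"
  shows "{\<phi> Y, \<phi> Z} \<in> coxeter_trickle_edges W S m"
proof -
  have "\<phi> Y \<noteq> \<phi> Z" using e map_map by (metis edge_iff)
  moreover have "\<phi> Y \<in> S_fi W S m" "\<phi> Z \<in> S_fi W S m"
    using map_star Y Z by (auto simp: star_iff[OF X])
  moreover have "\<phi> Y \<subseteq> \<phi> Z \<or> \<phi> Z \<subseteq> \<phi> Y \<or> coxeter_disjoint_union S m (\<phi> Y) (\<phi> Z)"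
    using e map_mono[OF Y Z] map_mono[OF Z Y] map_disjoint_union[OF Y Z]
    by (auto simp: edge_iff)
  ultimately show ?thesis by (auto simp: edge_iff)
qed

lemma map_bij: "bij_betw \<phi> st st"
  by (rule bij_betwI[of _ _ _ \<phi>]) (auto simp: map_star map_map)

lemma map_automorphism:
  "graph_automorphism st (full_edges (coxeter_trickle_edges W S m) st) \<phi>"
  unfolding graph_automorphism_def
proof (intro conjI ballI)
  fix Y Z assume Y: "Y \<in> st" and Z: "Z \<in> st"
  show "{Y, Z} \<in> full_edges (coxeter_trickle_edges W S m) st \<longleftrightarrow>
    {\<phi> Y, \<phi> Z} \<in> full_edges (coxeter_trickle_edges W S m) st"
    using map_edge[OF Y Z] map_edge[OF map_star[OF Y] map_star[OF Z]] Y Z map_star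
    by (auto simp: full_edges_def map_map)
qed (rule map_bij)

lemma map_order:
  "group.ord (BijGroup st) (restrict \<phi> st) \<noteq> 0 \<and> group.ord (BijGroup st) (restrict \<phi> st) dvd 2"
proof -
  interpret B: group "BijGroup st" by (rule group_BijGroup)
  have "restrict \<phi> st \<in> Bij st"
    using map_bij by (auto simp: Bij_def cong: bij_betw_cong)
  then have carrier: "restrict \<phi> st \<in> carrier (BijGroup st)" by (simp add: BijGroup_def)
  have "restrict \<phi> st \<otimes>\<^bsub>BijGroup st\<^esub> restrict \<phi> st = \<one>\<^bsub>BijGroup st\<^esub>"
    using carrier by (auto simp: BijGroup_def compose_def map_map map_star restrict_def fun_eq_iff)
  then have "restrict \<phi> st [^]\<^bsub>BijGroup st\<^esub> (2::nat) = \<one>\<^bsub>BijGroup st\<^esub>"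
    using carrier by (simp add: numeral_2_eq_2)
  then have "B.ord (restrict \<phi> st) dvd 2" using B.pow_eq_id[OF carrier] by simp
  then show ?thesis by (metis dvd_0_left_iff zero_neq_numeral)
qed

text \<open>
  Element by element this is \<open>w\<^sub>X (w\<^sub>Y z w\<^sub>Y\<inverse>) w\<^sub>X\<inverse> = w' (w\<^sub>X z w\<^sub>X\<inverse>) w'\<inverse>\<close> for
  \<open>w' = w\<^sub>X w\<^sub>Y w\<^sub>X\<inverse>\<close>, which is the longest element of the conjugate of \<open>Y\<close>.
\<close>

lemma map_comp:
  assumes Y: "Y \<in> S_fi W S m" "Y \<subset> X" and Z: "Z \<in> S_fi W S m" "Z \<subset> Y"
  shows "\<phi> (coxeter_trickle_map W S Y Z) = coxeter_trickle_map W S (\<phi> Y) (\<phi> Z)"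
proof -
  have YS: "Y \<subseteq> S" "spherical_subset W Y" using S_fi_D[OF Y(1)] by auto
  have YZ: "lconj Y ` Z \<subset> X"
    using lconj_generator[OF YS] Z(2) Y(2) by blast
  have ZX: "Z \<subset> X" using Y Z by blast
  have "lconj X ` Z \<subset> lconj X ` Y"
  proof -
    have "lconj X ` Z \<noteq> lconj X ` Y"
      using Z(2) Y(2) lconj_image_image[of Y] lconj_image_image[of Z] by auto
    then show ?thesis using Z(2) by blast
  qed
  moreover have "lconj X (lconj Y z) = lconj (lconj X ` Y) (lconj X z)" if z: "z \<in> Z" for z
  proof -
    have zW: "z \<in> carrier W" using z Z Y vertex_spherical by (meson S_closed psubsetE subsetD)
    have "longest_element W S (lconj X ` Y) = lconj X (longest_element W S Y)"
      using longest_element_lconj[OF vertex_spherical] Y by blast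
    moreover have "inv (lconj X (longest_element W S Y)) = lconj X (inv (longest_element W S Y))"
      using group_hom.hom_inv[OF lconj_hom[OF vertex_spherical]] longest_closed[OF YS] by simp
    ultimately show ?thesis
      unfolding lconj_def[of Y] lconj_def[of "lconj X ` Y"]
      using zW longest_closed[OF YS] by (simp add: lconj_mult[OF vertex_spherical] lconj_closed[OF vertex_spherical])
  qed
  ultimately show ?thesis
    using Y(2) Z(2) ZX YZ
    by (simp add: coxeter_trickle_map_def longest_conj_image image_image)
qed

end

end

theorem lemma2p1:
  fixes W :: "('a, 'b) monoid_scheme"
    and S :: "'a set"
    and m :: "'a \<Rightarrow> 'a \<Rightarrow> enat"
  assumes "coxeter_system W S m"
  shows "trickle_graph (S_fi W S m) (coxeter_trickle_edges W S m) (\<subseteq>) (\<lambda>X. 2)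
           (coxeter_trickle_map W S)"
proof -
  interpret coxeter_group W S m by unfold_locales (rule assms)
  show ?thesis
  proof
    show "simplicial_graph (S_fi W S m) (coxeter_trickle_edges W S m)"
      unfolding simplicial_graph_def
    proof
      fix e assume "e \<in> coxeter_trickle_edges W S m"
      then obtain X Y where "e = {X, Y}" "X \<in> S_fi W S m" "Y \<in> S_fi W S m" "X \<noteq> Y"
        unfolding coxeter_trickle_edges_def by blast
      then show "e \<subseteq> S_fi W S m \<and> card e = 2" by simp
    qed
    show "partial_order_on (S_fi W S m) {(X, Y). X \<in> S_fi W S m \<and> Y \<in> S_fi W S m \<and> X \<subseteq> Y}"
      by (auto simp: partial_order_on_def preorder_on_def refl_on_def trans_def antisym_def)
  next
    fix X :: "'a set" and n
    assume "(2::enat) = enat n"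
    then have n: "n = 2" by (simp add: numeral_eq_enat)
    assume "X \<in> S_fi W S m"
    then show "group.ord (BijGroup (star (coxeter_trickle_edges W S m) X))
          (restrict (coxeter_trickle_map W S X) (star (coxeter_trickle_edges W S m) X)) \<noteq> 0 \<and>
        group.ord (BijGroup (star (coxeter_trickle_edges W S m) X))
          (restrict (coxeter_trickle_map W S X) (star (coxeter_trickle_edges W S m) X)) dvd n"
      unfolding n by (rule map_order)
  next
    fix X Y Z
    assume X: "X \<in> S_fi W S m"
      and Y: "Y \<in> star (coxeter_trickle_edges W S m) X"
      and Z: "Z \<in> star (coxeter_trickle_edges W S m) X"
    then show "Z \<subseteq> Y \<longleftrightarrow> coxeter_trickle_map W S X Z \<subseteq> coxeter_trickle_map W S X Y"
      using map_mono[OF X Y Z] map_mono[OF X map_star[OF X Y] map_star[OF X Z]]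
      by (auto simp: map_map[OF X])
  next
    fix X Y Z
    assume V: "X \<in> S_fi W S m" "Y \<in> S_fi W S m" "Z \<in> S_fi W S m"
      and e: "{X, Y} \<in> coxeter_trickle_edges W S m" "\<not> X \<subseteq> Y" "\<not> Y \<subseteq> X" and "Z \<subseteq> Y"
    then have disj: "coxeter_disjoint_union S m X Z"
      using disjoint_union_mono by (auto simp: edge_iff)
    then show "{X, Z} \<in> coxeter_trickle_edges W S m \<and> \<not> X \<subseteq> Z \<and> \<not> Z \<subseteq> X"
      using disjoint_union_incomparable[OF disj] V by (auto simp: edge_iff)
  next
    fix X Y Z
    assume "X \<in> S_fi W S m" "Y \<in> S_fi W S m" "Z \<in> S_fi W S m"
      and "Z \<subseteq> Y" "Z \<noteq> Y" "Y \<subseteq> X" "Y \<noteq> X"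
    then show "coxeter_trickle_map W S X (coxeter_trickle_map W S Y Z) =
        coxeter_trickle_map W S (coxeter_trickle_map W S X Y) (coxeter_trickle_map W S X Z)"
      by (intro map_comp) auto
  next
    fix X Y
    assume "coxeter_trickle_map W S X Y \<noteq> Y"
    then show "Y \<subseteq> X \<and> Y \<noteq> X"
      unfolding coxeter_trickle_map_def by (meson psubset_eq)
  next
    fix X Y
    assume "X \<in> S_fi W S m" "Y \<in> S_fi W S m" "X \<subseteq> Y" "X \<noteq> Y"
    then show "{X, Y} \<in> coxeter_trickle_edges W S m"
      unfolding edge_iff by blast
  next
    fix X
    assume "X \<in> S_fi W S m"
    then show "graph_automorphism (star (coxeter_trickle_edges W S m) X)
        (full_edges (coxeter_trickle_edges W S m) (star (coxeter_trickle_edges W S m) X))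
        (coxeter_trickle_map W S X)"
      by (rule map_automorphism)
  qed simp_all
qed

end
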